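(* Let $m\ge 1$, $k\ge 0$ and $n\ge 0$ be integers and write $N=(2k+1)n+r$ with $0\le r\le 2k$. Then for $c$ an indeterminate, we have, when $k\ge m-1$, \[ \det_{0\leq i,j \leq N-1}\big(\mathrm{Cat}_{i+j+m,k}^{(1,c)}\big) = \begin{cases} \left(\frac{F_{(2k+1)n}(c)}{F_{2k+1}(c)} + \frac{F_{(2k+1)(n+1)}(c)}{F_{2k+1}(c)}\right)^m, & \text{if } r=0,\\[6pt] (-1)^{\binom{k-m+1}{2}} \left(\frac{F_{(2k+1)n}(c)}{F_{2k+1}(c)} + \frac{F_{(2k+1)(n+1)}(c)}{F_{2k+1}(c)}\right)^m, & \text{if } r=k-m+1; \end{cases} \] and when $k\ge m$, \[ \det_{0\leq i,j \leq N-1}\big(\mathrm{Cat}_{i+j+m,k}^{(1,c)}\big) = \begin{cases} (-1)^{\binom{k+1}{2}}\big(L_{k+1}(c)+L_{k}(c)\big)^m\left(\frac{F_{(2k+1)(n+1)}(c)}{F_{2k+1}(c)}\right)^m, & \text{if } r=k+1,\\[6pt] (-1)^{\binom{m}{2}+mk}\big(L_{k+1}(c)+L_{k}(c)\big)^m\left(\frac{F_{(2k+1)(n+1)}(c)}{F_{2k+1}(c)}\right)^m, & \text{if } r=2k-m+1. \end{cases} \]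
   Context: For a sequence $(s_k)_{k\ge 0}$, let $\mathrm{Cat}_{n,k}^{(s)}$ be the array defined for $n\ge 1$, $k\ge 0$ by $\mathrm{Cat}_{n,k}^{(s)}=\mathrm{Cat}_{n-1,k-1}^{(s)}+s_k \mathrm{Cat}_{n-1,k}^{(s)}+\mathrm{Cat}_{n-1,k+1}^{(s)}$, with boundary values $\mathrm{Cat}_{0,0}^{(s)}=1$, $\mathrm{Cat}_{0,k}^{(s)}=0$ for $k\ge 1$, and $\mathrm{Cat}_{n,k}^{(s)}=0$ for $k<0$. For $b\in\{0,1\}$ write $\mathrm{Cat}_{n,k}^{(b,c)}$ for $\mathrm{Cat}_{n,k}^{(s)}$ with $s=(b+c,c,c,c,\ldots)$, i.e. $s_0=b+c$ and $s_k=c$ for $k\ge 1$. The polynomials $F_n(x)$ and $L_n(x)$ are defined by $F_0(x)=0$, $F_1(x)=1$, $F_n(x)=xF_{n-1}(x)-F_{n-2}(x)$ and $L_0(x)=2$, $L_1(x)=x$, $L_n(x)=xL_{n-1}(x)-L_{n-2}(x)$ for $n\ge 2$. The notation $\det_{0\le i,j\le N-1}(a_{i,j})$ is the determinant of the $N\times N$ matrix $(a_{i,j})$; the empty determinant ($N=0$) is $1$. *)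

theory Defs
  imports "Jordan_Normal_Form.Determinant" "HOL-Computational_Algebra.Polynomial_Factorial"
begin

(* The column index is a nat, so the boundary value 0 at negative column indices
   becomes the explicit 0 in the case k = 0 of the recursion. *)
fun Cat :: "(nat \<Rightarrow> 'a::comm_ring_1) \<Rightarrow> nat \<Rightarrow> nat \<Rightarrow> 'a" where
  "Cat s 0 k = (if k = 0 then 1 else 0)"
| "Cat s (Suc n) k =
     (case k of 0 \<Rightarrow> 0 | Suc l \<Rightarrow> Cat s n l) + s k * Cat s n k + Cat s n (Suc k)"

definition Cat_bc :: "'a::comm_ring_1 \<Rightarrow> 'a \<Rightarrow> nat \<Rightarrow> nat \<Rightarrow> 'a" where
  "Cat_bc b c = Cat (\<lambda>k. if k = 0 then b + c else c)"

fun F :: "nat \<Rightarrow> int poly" where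
  "F 0 = 0"
| "F (Suc 0) = 1"
| "F (Suc (Suc n)) = [:0, 1:] * F (Suc n) - F n"

fun L :: "nat \<Rightarrow> int poly" where
  "L 0 = 2"
| "L (Suc 0) = [:0, 1:]"
| "L (Suc (Suc n)) = [:0, 1:] * L (Suc n) - L n"

(* The indeterminate c is the variable [:0, 1:] of int poly, so that F n and L n
   are themselves the values F_n(c) and L_n(c). *)
definition Hankel_det :: "nat \<Rightarrow> nat \<Rightarrow> nat \<Rightarrow> int poly" where
  "Hankel_det N m k = det (mat N N (\<lambda>(i, j). Cat_bc 1 [:0, 1:] (i + j + m) k))"

(* F_(ab)(c) / F_a(c), formed in the fraction field of int poly. *)
definition F_quot :: "nat \<Rightarrow> nat \<Rightarrow> int poly fract" where
  "F_quot a b = to_fract (F (a * b)) / to_fract (F a)"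

end

theory Submission
  imports Defs
begin

text \<open>
  Write \<open>y = x - c\<close>. The orthogonal polynomials of the array are the Chebyshev polynomials of the
  third kind \<open>p\<^sub>n = cheb3 y n\<close>: with \<open>y = z + 1/z\<close> they are
  \<open>(z\<^bsup>n+1/2\<^esup> + z\<^bsup>-n-1/2\<^esup>) / (z\<^bsup>1/2\<^esup> + z\<^bsup>-1/2\<^esup>)\<close>. Since row \<open>n\<close> of the array lists the coordinates of
  \<open>x\<^sup>n\<close> in the basis \<open>p\<^sub>k\<close>, the entry at \<open>(i, j)\<close> of the Hankel matrix is the moment of
  \<open>x\<^sup>i x\<^sup>j q\<close>, where \<open>q = x\<^sup>m p\<^sub>k\<close> has degree \<open>d = k + m\<close>. A form of Christoffel's formula that does not
  mention the roots of \<open>q\<close> then holds (\<open>hankel_det_Cat\<close>): the Hankel determinant of order \<open>N\<close> is the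
  determinant of the coefficients of the \<open>N + d\<close> polynomials
  \<open>q, x q, \<dots>, x\<^bsup>N-1\<^esup> q, p\<^sub>N, \<dots>, p\<^bsub>N+d-1\<^esub>\<close>. In other words, it measures the classes of
  \<open>p\<^sub>N, \<dots>, p\<^bsub>N+d-1\<^esub>\<close> modulo \<open>q\<close>.

  These classes are handled first modulo \<open>p\<^sub>k\<close>, then modulo \<open>x\<^sup>m\<close> (\<open>fdet_christoffel\<close>). At the
  roots of \<open>p\<^sub>k\<close> one has \<open>z\<^bsup>2k+1\<^esup> = -1\<close>, so modulo \<open>p\<^sub>k\<close> the sequence \<open>p\<^sub>n\<close> changes its sign under
  \<open>n \<mapsto> n + 2k + 1\<close>, and with \<open>M = (2k+1)n\<close> it is antisymmetric about the centre \<open>M + k\<close> and symmetric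
  about the boundary \<open>(2k+1)(n+1) - 1/2\<close>. For the four values of \<open>r\<close> the window
  \<open>p\<^sub>N, \<dots>, p\<^bsub>N+d-1\<^esub>\<close> consists of \<open>k\<close> consecutive members whose residues are, up to sign,
  \<open>p\<^sub>0, \<dots>, p\<^bsub>k-1\<^esub>\<close> in increasing or decreasing order, and of \<open>m\<close> more members, each of which differs
  from \<open>p\<^sub>k\<close> times \<open>G\<close> times a monic polynomial, up to sign, at most by one of the \<open>k\<close> members, its
  mirror image. At the centre, where \<open>G = p\<^bsub>M+k\<^esub> / p\<^sub>k\<close>, this follows from
  \<open>p\<^bsub>M+k+b\<^esub> + p\<^bsub>M+k-b\<^esub> = p\<^bsub>M+k\<^esub> L\<^sub>b(y)\<close> for \<open>b \<ge> 1\<close>; at the boundary, from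
  \<open>p\<^bsub>S+a\<^esub> - p\<^bsub>S-1-a\<^esub> = F\<^sub>S(y) (y - 2) (F\<^bsub>a+1\<^esub>(y) + F\<^sub>a(y))\<close> with \<open>S = (2k+1)(n+1)\<close>,
  where \<open>G = F\<^sub>S(y) (y - 2) / p\<^sub>k\<close>. Since the remaining factors are monic of degrees \<open>0, \<dots>, m - 1\<close>, the determinant
  modulo \<open>x\<^sup>m\<close> is \<open>G(0)\<^sup>m\<close>, up to the sign of a reversal of the rows. At \<open>x = 0\<close> the argument \<open>y\<close>
  is \<open>-c\<close>, and
  \<open>F\<^bsub>2k+1\<^esub> = (F\<^bsub>k+1\<^esub> - F\<^sub>k) (F\<^bsub>k+1\<^esub> + F\<^sub>k)\<close> and \<open>L\<^bsub>k+1\<^esub> + L\<^sub>k = (c + 2) (F\<^bsub>k+1\<^esub> - F\<^sub>k)\<close> turn \<open>G(0)\<close> into the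
  stated quotients, up to sign.
\<close>

section \<open>Determinants of matrices given by their entries\<close>

definition fdet :: "nat \<Rightarrow> (nat \<Rightarrow> nat \<Rightarrow> 'a::comm_ring_1) \<Rightarrow> 'a" where
  "fdet n a = det (mat n n (\<lambda>(i, j). a i j))"

lemma fdet_cong:
  assumes "\<And>i j. i < n \<Longrightarrow> j < n \<Longrightarrow> a i j = b i j"
  shows "fdet n a = fdet n b"
  unfolding fdet_def using assms by (intro arg_cong[of _ _ det] eq_matI) auto

lemma fdet_mult:
  "fdet n a * fdet n b = fdet n (\<lambda>i j. \<Sum>l<n. a i l * b l j)"
proof -
  have "mat n n (\<lambda>(i, j). a i j) * mat n n (\<lambda>(i, j). b i j)
      = mat n n (\<lambda>(i, j). \<Sum>l<n. a i l * b l j)"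
    by (intro eq_matI) (auto simp: scalar_prod_def atLeast0LessThan intro!: sum.cong)
  thus ?thesis unfolding fdet_def by (subst det_mult[symmetric, of _ n]) auto
qed

lemma fdet_upper_triangular:
  assumes "\<And>i j. j < i \<Longrightarrow> i < n \<Longrightarrow> a i j = 0"
  shows "fdet n a = (\<Prod>i<n. a i i)"
proof -
  have "fdet n a = prod_list (diag_mat (mat n n (\<lambda>(i, j). a i j)))"
    unfolding fdet_def by (rule det_upper_triangular[of _ n]) (auto simp: upper_triangular_def assms)
  also have "\<dots> = (\<Prod>i<n. a i i)"
    by (subst prod_list_diag_prod) (auto simp: atLeast0LessThan)
  finally show ?thesis .
qed

lemma fdet_lower_triangular:
  assumes "\<And>i j. i < j \<Longrightarrow> j < n \<Longrightarrow> a i j = 0"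
  shows "fdet n a = (\<Prod>i<n. a i i)"
proof -
  have "fdet n a = prod_list (diag_mat (mat n n (\<lambda>(i, j). a i j)))"
    unfolding fdet_def by (rule det_lower_triangular[of n]) (auto simp: assms)
  also have "\<dots> = (\<Prod>i<n. a i i)"
    by (subst prod_list_diag_prod) (auto simp: atLeast0LessThan)
  finally show ?thesis .
qed

lemma fdet_block_upper:
  fixes a :: "nat \<Rightarrow> nat \<Rightarrow> 'a::idom"
  assumes "\<And>i j. n \<le> i \<Longrightarrow> i < n + m \<Longrightarrow> j < n \<Longrightarrow> a i j = 0"
  shows "fdet (n + m) a = fdet n a * fdet m (\<lambda>i j. a (n + i) (n + j))"
proof -
  have "mat (n + m) (n + m) (\<lambda>(i, j). a i j)
      = four_block_mat (mat n n (\<lambda>(i, j). a i j)) (mat n m (\<lambda>(i, j). a i (n + j)))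
          (0\<^sub>m m n) (mat m m (\<lambda>(i, j). a (n + i) (n + j)))"
    by (intro eq_matI) (auto simp: assms)
  thus ?thesis unfolding fdet_def
    by (subst det_four_block_mat_lower_left_zero[symmetric, where n = n and m = m]) auto
qed

lemma fdet_block_lower:
  fixes a :: "nat \<Rightarrow> nat \<Rightarrow> 'a::idom"
  assumes "\<And>i j. i < n \<Longrightarrow> n \<le> j \<Longrightarrow> j < n + m \<Longrightarrow> a i j = 0"
  shows "fdet (n + m) a = fdet n a * fdet m (\<lambda>i j. a (n + i) (n + j))"
proof -
  have "mat (n + m) (n + m) (\<lambda>(i, j). a i j)
      = four_block_mat (mat n n (\<lambda>(i, j). a i j)) (0\<^sub>m n m)
          (mat m n (\<lambda>(i, j). a (n + i) j)) (mat m m (\<lambda>(i, j). a (n + i) (n + j)))"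
    by (intro eq_matI) (auto simp: assms)
  thus ?thesis unfolding fdet_def
    by (subst det_four_block_mat_upper_right_zero[symmetric, where n = n and m = m]) auto
qed

text \<open>Moving a block of \<open>l\<close> rows in front of the \<open>k\<close> rows above it takes \<open>k * l\<close> transpositions of
  neighbours.\<close>

lemma fdet_swap_blocks:
  assumes "k + l \<le> n"
  shows "fdet n a = (-1) ^ (k * l) *
    fdet n (\<lambda>i. a (if i < l then i + k else if i < k + l then i - l else i))"
proof -
  have "fdet n a = (-1) ^ (k * l) * det (mat n n (\<lambda>(i, j). mat n n (\<lambda>(i, j). a i j)
          $$ (if i < l then i + k else if i < k + l then i - l else i, j)))"
    unfolding fdet_def using assms by (intro det_swap_initial_rows) auto
  also have "mat n n (\<lambda>(i, j). mat n n (\<lambda>(i, j). a i j)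
          $$ (if i < l then i + k else if i < k + l then i - l else i, j))
      = mat n n (\<lambda>(i, j). a (if i < l then i + k else if i < k + l then i - l else i) j)"
    using assms by (intro eq_matI) auto
  finally show ?thesis unfolding fdet_def .
qed

lemma fdet_reverse_rows:
  "fdet n (\<lambda>i. a (n - 1 - i)) = (-1) ^ (n choose 2) * fdet n a"
proof -
  \<comment> \<open>Reverse the first j rows one at a time: the next row moves in front of the j rows that
    are reversed already.\<close>
  have "fdet n (\<lambda>i. a (if i < j then j - 1 - i else i)) = (-1) ^ (j choose 2) * fdet n a"
    if "j \<le> n" for j
    using that
  proof (induction j)
    case 0
    then show ?case by (simp add: numeral_2_eq_2)
  next
    case (Suc j)
    have "fdet n (\<lambda>i. a (if i < j then j - 1 - i else i)) = (-1) ^ (j * 1) *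
       fdet n (\<lambda>i. a (if (if i < 1 then i + j else if i < j + 1 then i - 1 else i) < j
                 then j - 1 - (if i < 1 then i + j else if i < j + 1 then i - 1 else i)
                 else (if i < 1 then i + j else if i < j + 1 then i - 1 else i)))"
      using Suc.prems by (subst fdet_swap_blocks[of j 1]) auto
    also have "fdet n (\<lambda>i. a (if (if i < 1 then i + j else if i < j + 1 then i - 1 else i) < j
                 then j - 1 - (if i < 1 then i + j else if i < j + 1 then i - 1 else i)
                 else (if i < 1 then i + j else if i < j + 1 then i - 1 else i)))
       = fdet n (\<lambda>i. a (if i < Suc j then Suc j - 1 - i else i))"
      by (intro fdet_cong arg_cong2[of _ _ _ _ a] refl) auto
    finally have "fdet n (\<lambda>i. a (if i < Suc j then Suc j - 1 - i else i))
       = (-1) ^ j * fdet n (\<lambda>i. a (if i < j then j - 1 - i else i))"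
      by (simp flip: power_add mult.assoc)
    also have "\<dots> = (-1) ^ (Suc j choose 2) * fdet n a"
      using Suc by (simp add: numeral_2_eq_2 power_add flip: mult.assoc)
    finally show ?case .
  qed
  from this[of n] have "fdet n (\<lambda>i. a (if i < n then n - 1 - i else i)) = (-1) ^ (n choose 2) * fdet n a"
    by simp
  moreover have "fdet n (\<lambda>i. a (if i < n then n - 1 - i else i)) = fdet n (\<lambda>i. a (n - 1 - i))"
    by (intro fdet_cong) auto
  ultimately show ?thesis by simp
qed

lemma fdet_smult_rows: "fdet n (\<lambda>i j. e * a i j) = e ^ n * fdet n a"
proof -
  have "fdet n (\<lambda>i l. if i = l then e else 0) * fdet n a = fdet n (\<lambda>i j. e * a i j)"
    unfolding fdet_mult by (intro fdet_cong) (simp add: if_distrib[of "\<lambda>x. x * _"] cong: if_cong)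
  thus ?thesis by (subst (asm) fdet_lower_triangular) auto
qed

lemma sum_lessThan_add:
  fixes g :: "nat \<Rightarrow> 'a::comm_monoid_add"
  shows "sum g {..<a + b} = sum g {..<a} + (\<Sum>i<b. g (a + i))"
  by (induction b) (auto simp: add_ac)

lemma fdet_add_initial_rows:
  "fdet (k + M) (\<lambda>i j. if i < k then a i j else a i j + (\<Sum>l<k. E i l * a l j)) = fdet (k + M) a"
proof -
  define T where "T = (\<lambda>i l. (if i = l then 1 else 0) + (if k \<le> i \<and> l < k then E i l else 0))"
  have "(\<Sum>l<k + M. T i l * a l j) = (if i < k then a i j else a i j + (\<Sum>l<k. E i l * a l j))"
    if "i < k + M" for i j
  proof -
    have "(\<Sum>l<k + M. T i l * a l j)
        = (\<Sum>l<k + M. (if i = l then a l j else 0))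
          + (\<Sum>l<k + M. (if k \<le> i \<and> l < k then E i l * a l j else 0))"
      unfolding T_def by (subst sum.distrib[symmetric]) (auto intro!: sum.cong simp: distrib_right)
    also have "(\<Sum>l<k + M. (if i = l then a l j else 0)) = a i j"
      using that by simp
    also have "(\<Sum>l<k + M. (if k \<le> i \<and> l < k then E i l * a l j else 0))
        = (if i < k then 0 else \<Sum>l<k. E i l * a l j)"
      by (auto simp: sum_lessThan_add)
    finally show ?thesis by simp
  qed
  hence "fdet (k + M) (\<lambda>i j. if i < k then a i j else a i j + (\<Sum>l<k. E i l * a l j))
      = fdet (k + M) T * fdet (k + M) a"
    unfolding fdet_mult by (intro fdet_cong) simp
  also have "fdet (k + M) T = 1"
    by (subst fdet_lower_triangular) (auto simp: T_def intro!: prod.neutral)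
  finally show ?thesis by simp
qed

section \<open>Monic orthogonal polynomials and their moments\<close>

text \<open>These are the monic polynomials whose three-term recurrence has the coefficients of the
  recursion for \<^const>\<open>Cat\<close>.\<close>

fun ops :: "(nat \<Rightarrow> 'a::comm_ring_1) \<Rightarrow> nat \<Rightarrow> 'a poly" where
  "ops s 0 = 1"
| "ops s (Suc 0) = [:- s 0, 1:]"
| "ops s (Suc (Suc n)) = [:- s (Suc n), 1:] * ops s (Suc n) - ops s n"

lemma coeff_ops:
  "coeff (ops s n) n = 1" "n < j \<Longrightarrow> coeff (ops s n) j = 0"
proof (induction s n arbitrary: j rule: ops.induct)
  case (3 s n)
  {
    case 1
    show ?case using 3 by simp
  next
    case 2
    then obtain i where "j = Suc i" by (cases j) auto
    with 2 3 show ?case by simp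
  }
qed (auto simp: coeff_pCons split: nat.splits)

lemma degree_ops: "degree (ops s n) = n"
  by (rule antisym) (auto intro!: degree_le le_degree simp: coeff_ops)

lemma Cat_triangular:
  "n < k \<Longrightarrow> Cat s n k = 0" "Cat s n n = 1"
  by (induction n arbitrary: k) (auto split: nat.splits)

text \<open>Iterating the recursion of the array expands \<open>x ^ n\<close> as the combination of the orthogonal
  polynomials \<open>ops s k\<close> with coefficients \<open>Cat s n k\<close>; so this is the coordinate of \<open>f\<close> at
  \<open>ops s k\<close>, and at \<open>k = 0\<close> it is the moment functional.\<close>

definition coord :: "(nat \<Rightarrow> 'a::comm_ring_1) \<Rightarrow> nat \<Rightarrow> 'a poly \<Rightarrow> 'a" where
  "coord s k f = (\<Sum>i\<le>degree f. coeff f i * Cat s i k)"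

lemma coord_eq_sum:
  assumes "degree f < B"
  shows "coord s k f = (\<Sum>i<B. coeff f i * Cat s i k)"
  unfolding coord_def using assms
  by (intro sum.mono_neutral_left) (auto simp: coeff_eq_0)

lemma poly_eq_sum_monom:
  fixes f :: "'a::comm_ring_1 poly"
  assumes "\<And>j. n \<le> j \<Longrightarrow> coeff f j = 0"
  shows "f = (\<Sum>i<n. smult (coeff f i) (monom 1 i))"
proof (rule poly_eqI)
  fix j
  have "coeff (\<Sum>i<n. smult (coeff f i) (monom 1 i)) j = (\<Sum>i<n. if i = j then coeff f i else 0)"
    unfolding coeff_sum by (intro sum.cong) auto
  thus "coeff f j = coeff (\<Sum>i<n. smult (coeff f i) (monom 1 i)) j"
    using assms[of j] by auto
qed

lemma coord_diff: "coord s k (f - g) = coord s k f - coord s k g"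
proof -
  define B where "B = Suc (max (degree f) (degree g))"
  have "degree (f - g) < B" "degree f < B" "degree g < B"
    unfolding B_def using degree_diff_le_max[of f g] by auto
  thus ?thesis by (simp add: coord_eq_sum[of _ B] left_diff_distrib sum_subtractf)
qed

lemma coord_sum_smult:
  "coord s k (\<Sum>i\<in>A. smult (u i) (g i)) = (\<Sum>i\<in>A. u i * coord s k (g i))"
proof -
  have add: "coord s k (f + g) = coord s k f + coord s k g" for f g
    using coord_diff[of s k "f + g" g] by simp
  have smult: "coord s k (smult u f) = u * coord s k f" for u f
    using coord_eq_sum[of "smult u f" "Suc (degree f)"] coord_eq_sum[of f "Suc (degree f)"]
    by (simp add: sum_distrib_left mult.assoc le_imp_less_Suc degree_smult_le lessThan_Suc_atMost)
  have zero: "coord s k 0 = 0" using coord_diff[of s k 0 0] by simp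
  show ?thesis by (induction A rule: infinite_finite_induct) (auto simp: add smult zero)
qed

lemma coord_x_mult:
  "coord s k (pCons 0 f)
     = (case k of 0 \<Rightarrow> 0 | Suc l \<Rightarrow> coord s l f) + s k * coord s k f + coord s (Suc k) f"
proof -
  define B where "B = Suc (degree f)"
  have "degree (pCons 0 f) < Suc B" "degree f < B"
    unfolding B_def by (auto intro: le_imp_less_Suc degree_pCons_le)
  hence "coord s k (pCons 0 f) = (\<Sum>i<B. coeff f i * Cat s (Suc i) k)"
    by (simp add: coord_eq_sum[of _ "Suc B"] sum.lessThan_Suc_shift del: sum.lessThan_Suc Cat.simps)
  also have "\<dots> = (case k of 0 \<Rightarrow> 0 | Suc l \<Rightarrow> coord s l f) + s k * coord s k f + coord s (Suc k) f"
    using \<open>degree f < B\<close>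
    by (auto simp: coord_eq_sum[of _ B] algebra_simps sum.distrib sum_distrib_left split: nat.splits)
  finally show ?thesis .
qed

text \<open>Multiplication by \<open>x\<close> is a symmetric operator in the basis \<open>ops s k\<close> (the recursion of the array
  treats \<open>k - 1\<close> and \<open>k + 1\<close> alike), so the coordinate at \<open>ops s k\<close> is obtained by applying
  \<open>ops s k\<close>, as a polynomial in this operator, to the coordinate at \<open>ops s 0\<close>.\<close>

lemma coord_eq_moment: "coord s k f = coord s 0 (ops s k * f)"
proof (induction s k arbitrary: f rule: ops.induct)
  case (2 s)
  have "coord s 0 ([:- s 0, 1:] * f) = coord s 0 (pCons 0 f) - s 0 * coord s 0 f"
    using coord_diff[of s 0 "pCons 0 f" "smult (s 0) f"]
      coord_sum_smult[of s 0 "\<lambda>_. s 0" "\<lambda>_. f" "{0::nat}"] by (simp add: algebra_simps)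
  also have "\<dots> = coord s 1 f" by (simp add: coord_x_mult)
  finally show ?case by simp
next
  case (3 s n)
  have "[:- s (Suc n), 1:] * ops s (Suc n) * f
      = ops s (Suc n) * pCons 0 f - smult (s (Suc n)) (ops s (Suc n) * f)"
    by (simp add: algebra_simps)
  hence "coord s 0 (ops s (Suc (Suc n)) * f)
      = coord s 0 (ops s (Suc n) * pCons 0 f) - s (Suc n) * coord s 0 (ops s (Suc n) * f)
        - coord s 0 (ops s n * f)"
    using coord_sum_smult[of s 0 "\<lambda>_. s (Suc n)" "\<lambda>_. ops s (Suc n) * f" "{0::nat}"]
    by (simp add: left_diff_distrib coord_diff)
  also have "\<dots> = coord s (Suc n) (pCons 0 f) - s (Suc n) * coord s (Suc n) f - coord s n f"
    using 3 by simp
  also have "\<dots> = coord s (Suc (Suc n)) f" by (simp add: coord_x_mult)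
  finally show ?case by simp
qed simp

text \<open>Orthonormality. On one side of the diagonal it is the triangular shape of the array, and
  the moment form of the coordinates is symmetric.\<close>

lemma coord_ops: "coord s l (ops s j) = (if l = j then 1 else 0)"
proof -
  have *: "coord s l (ops s j) = (if l = j then 1 else 0)" if "j \<le> l" for l j
  proof -
    have "coord s l (ops s j) = (\<Sum>i<j. coeff (ops s j) i * Cat s i l) + Cat s j l"
      by (simp add: coord_eq_sum[of _ "Suc j"] degree_ops coeff_ops)
    also have "\<dots> = (if l = j then 1 else 0)"
      using that by (auto simp: Cat_triangular)
    finally show ?thesis .
  qed
  show ?thesis
    using *[of j l] *[of l j] coord_eq_moment[of s l "ops s j"] coord_eq_moment[of s j "ops s l"]
    by (cases "j \<le> l") (auto simp: mult.commute)
qed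

lemma coord_monom: "coord s k (monom 1 n) = Cat s n k"
proof -
  have "degree (monom (1::'a) n) < Suc n" by (simp add: degree_monom_le le_imp_less_Suc)
  thus ?thesis by (simp add: coord_eq_sum[of _ "Suc n"] sum.delta if_distrib[of "\<lambda>x. x * _"] cong: if_cong)
qed

text \<open>The root-free Christoffel formula. In terms of the basis of orthogonal polynomials, the last
  \<open>k + m\<close> rows on the right are unit vectors, so that only the leading block of order \<open>N\<close> contributes;
  it holds the moments of \<open>ops s l * x ^ (m + j) * ops s k\<close> and arises from the Hankel matrix by a
  unitriangular change of basis.\<close>

lemma hankel_det_Cat:
  fixes s :: "nat \<Rightarrow> 'a::idom"
  shows "fdet N (\<lambda>i j. Cat s (i + j + m) k)
    = fdet (N + (k + m)) (\<lambda>i. coeff (if i < N then monom 1 (m + i) * ops s k else ops s i))"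
    (is "?H = fdet ?D (\<lambda>i. coeff (?f i))")
proof -
  have deg: "degree (?f i) < ?D" if "i < ?D" for i
    using that degree_mult_le[of "monom 1 (m + i)" "ops s k"] degree_monom_le[of "1::'a" "m + i"]
    by (auto simp: degree_ops)
  have "?H = ?H * fdet N (\<lambda>i l. coeff (ops s l) i)"
    by (subst (2) fdet_upper_triangular) (auto simp: coeff_ops)
  also have "\<dots> = fdet N (\<lambda>j l. coord s l (?f j))"
    unfolding fdet_mult
  proof (intro fdet_cong)
    fix j l assume jl: "j < N" "l < N"
    have ops_l: "ops s l = (\<Sum>i<N. smult (coeff (ops s l) i) (monom 1 i))"
      using jl by (intro poly_eq_sum_monom) (simp add: coeff_ops)
    have "(\<Sum>i<N. Cat s (j + i + m) k * coeff (ops s l) i)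
        = (\<Sum>i<N. coeff (ops s l) i * coord s 0 (ops s k * monom 1 (j + i + m)))"
      by (simp add: coord_eq_moment[symmetric] coord_monom mult.commute)
    also have "\<dots> = coord s 0 (\<Sum>i<N. smult (coeff (ops s l) i) (ops s k * monom 1 (j + i + m)))"
      by (simp only: coord_sum_smult)
    also have "(\<Sum>i<N. smult (coeff (ops s l) i) (ops s k * monom 1 (j + i + m))) = ops s l * ?f j"
    proof -
      have "monom 1 (j + i + m) = (monom 1 i * monom 1 (m + j) :: 'a poly)" for i
        by (simp add: mult_monom add_ac)
      thus ?thesis
        using jl by (subst (2) ops_l) (simp add: sum_distrib_right, simp add: mult_ac)
    qed
    finally show "(\<Sum>i<N. Cat s (j + i + m) k * coeff (ops s l) i) = coord s l (?f j)"
      by (simp only: coord_eq_moment[of s l "?f j"])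
  qed
  also have "\<dots> = fdet N (\<lambda>j l. coord s l (?f j))
                  * fdet (k + m) (\<lambda>i l. coord s (N + l) (?f (N + i)))"
    by (subst (2) fdet_lower_triangular) (auto simp: coord_ops)
  also have "\<dots> = fdet ?D (\<lambda>j l. coord s l (?f j))"
    by (rule fdet_block_upper[symmetric]) (auto simp: coord_ops)
  also have "\<dots> = fdet ?D (\<lambda>i. coeff (?f i)) * fdet ?D (\<lambda>t l. Cat s t l)"
    unfolding fdet_mult using deg by (intro fdet_cong) (simp add: coord_eq_sum)
  also have "fdet ?D (\<lambda>t l. Cat s t l) = 1"
    by (subst fdet_lower_triangular) (auto simp: Cat_triangular)
  finally show ?thesis by simp
qed

section \<open>Determinants of coefficients modulo a polynomial\<close>

lemma fdet_coeff_smult: "fdet n (\<lambda>i. coeff (smult e (f i))) = e ^ n * fdet n (\<lambda>i. coeff (f i))"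
proof -
  have "fdet n (\<lambda>i. coeff (smult e (f i))) = fdet n (\<lambda>i j. e * coeff (f i) j)"
    by (rule fdet_cong) simp
  thus ?thesis by (simp only: fdet_smult_rows)
qed

text \<open>A determinant version of division with remainder: the polynomials of degree below \<open>k + M\<close> are the
  direct sum of the remainders modulo \<open>p\<close> and the multiples of \<open>p\<close>, and in a basis adapted to
  this splitting the matrix is block triangular.\<close>

lemma fdet_coeff_mod:
  fixes p :: "'a::idom poly"
  assumes p: "degree p = k" "coeff p k = 1"
    and deg: "\<And>i. i < k + M \<Longrightarrow> degree (f i) < k + M"
    and dvd: "\<And>i. i < k \<Longrightarrow> p dvd f i - \<rho> i"
    and \<rho>: "\<And>i j. i < k \<Longrightarrow> k \<le> j \<Longrightarrow> coeff (\<rho> i) j = 0"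
    and f: "\<And>i. i < M \<Longrightarrow> f (k + i) = p * h i"
  shows "fdet (k + M) (\<lambda>i. coeff (f i)) = fdet k (\<lambda>i. coeff (\<rho> i)) * fdet M (\<lambda>i. coeff (h i))"
proof -
  have quotient: "coeff u t = 0" if "degree (p * u) < k + M" "M \<le> t" for u t
  proof (cases "u = 0")
    case False
    moreover have "p \<noteq> 0" using p by auto
    ultimately have "degree u < M" using that(1) p by (simp add: degree_mult_eq)
    thus ?thesis using that(2) by (simp add: coeff_eq_0)
  qed simp
  have "\<forall>i. \<exists>u. i < k \<longrightarrow> f i - \<rho> i = p * u" using dvd by (auto simp: dvd_def)
  then obtain e where e: "\<And>i. i < k \<Longrightarrow> f i - \<rho> i = p * e i" by metis
  have deg_e: "coeff (e i) t = 0" if "i < k" "M \<le> t" for i t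
  proof (rule quotient[OF _ that(2)])
    have "degree (\<rho> i) < k" if "i < k"
      using \<rho>[OF that] that by (intro le_less_trans[OF degree_le[of "k - 1"]]) auto
    hence "degree (f i - \<rho> i) < k + M"
      using deg[of i] that by (intro degree_diff_less) auto
    thus "degree (p * e i) < k + M" by (simp only: e[OF that(1)])
  qed
  have deg_h: "coeff (h i) t = 0" if "i < M" "M \<le> t" for i t
    using deg[of "k + i"] f[OF that(1)] that by (intro quotient) auto
  \<comment> \<open>Expand every row in the basis of the powers below k followed by the products of p with
    powers.\<close>
  define A where "A = (\<lambda>i l. if i < k then if l < k then coeff (\<rho> i) l else coeff (e i) (l - k)
      else if l < k then 0 else coeff (h (i - k)) (l - k))"
  define B where "B = (\<lambda>l. if l < k then monom 1 l else p * monom 1 (l - k))"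
  have expand: "f i = (\<Sum>l<k + M. smult (A i l) (B l))" if "i < k + M" for i
  proof (cases "i < k")
    case True
    have "p * e i = p * (\<Sum>l<M. smult (coeff (e i) l) (monom 1 l))"
      using deg_e[OF True] by (subst poly_eq_sum_monom[of M "e i"]) auto
    moreover have "\<rho> i = (\<Sum>l<k. smult (coeff (\<rho> i) l) (monom 1 l))"
      using \<rho>[OF True] by (rule poly_eq_sum_monom)
    moreover have "f i = \<rho> i + p * e i" using e[OF True] by (simp add: algebra_simps)
    ultimately have "f i = (\<Sum>l<k. smult (coeff (\<rho> i) l) (monom 1 l))
        + (\<Sum>l<M. smult (coeff (e i) l) (p * monom 1 l))"
      by (simp add: sum_distrib_left)
    thus ?thesis using True by (simp add: sum_lessThan_add A_def B_def)
  next
    case False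
    with that have i: "i - k < M" "k + (i - k) = i" by auto
    have "p * h (i - k) = p * (\<Sum>l<M. smult (coeff (h (i - k)) l) (monom 1 l))"
      using deg_h[OF i(1)] by (subst poly_eq_sum_monom[of M "h (i - k)"]) auto
    hence "f i = (\<Sum>l<M. smult (coeff (h (i - k)) l) (p * monom 1 l))"
      using f[OF i(1)] i by (simp add: sum_distrib_left)
    thus ?thesis using False by (simp add: sum_lessThan_add A_def B_def)
  qed
  have "fdet (k + M) (\<lambda>i. coeff (f i)) = fdet (k + M) A * fdet (k + M) (\<lambda>l. coeff (B l))"
    unfolding fdet_mult by (intro fdet_cong) (simp add: expand coeff_sum)
  also have "fdet (k + M) (\<lambda>l. coeff (B l)) = (\<Prod>l<k + M. coeff (B l) l)"
    by (rule fdet_lower_triangular)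
       (use p in \<open>auto simp: B_def mult.commute[of p] coeff_monom_mult coeff_eq_0\<close>)
  also have "\<dots> = 1"
    by (rule prod.neutral) (use p in \<open>auto simp: B_def mult.commute[of p] coeff_monom_mult\<close>)
  also have "fdet (k + M) A = fdet k A * fdet M (\<lambda>i j. A (k + i) (k + j))"
    by (rule fdet_block_upper) (auto simp: A_def)
  also have "fdet k A = fdet k (\<lambda>i. coeff (\<rho> i))"
    by (rule fdet_cong) (auto simp: A_def)
  also have "fdet M (\<lambda>i j. A (k + i) (k + j)) = fdet M (\<lambda>i. coeff (h i))"
    by (rule fdet_cong) (auto simp: A_def)
  finally show ?thesis by simp
qed

text \<open>The same for the modulus \<open>x ^ m\<close>, where reduction is truncation: multiplication by \<open>G\<close> acts on the
  truncated polynomials by a triangular matrix with \<open>coeff G 0\<close> on the diagonal.\<close>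

lemma fdet_coeff_mod_power:
  fixes G :: "'a::idom poly"
  assumes W: "\<And>b j. b < m \<Longrightarrow> m \<le> j \<Longrightarrow> coeff (W b) j = 0"
  shows "fdet (m + N) (\<lambda>i. coeff (if i < m then G * W i else monom 1 i))
       = coeff G 0 ^ m * fdet m (\<lambda>i. coeff (W i))"
proof -
  define A where "A = (\<lambda>i l. if i < m then if l < m then coeff (W i) l else 0
      else if i = l then 1 else 0)"
  define B where "B = (\<lambda>l. if l < m then monom 1 l * G else monom 1 l)"
  have expand: "(if i < m then G * W i else monom 1 i) = (\<Sum>l<m + N. smult (A i l) (B l))"
    if "i < m + N" for i
  proof (cases "i < m")
    case True
    have "G * W i = G * (\<Sum>l<m. smult (coeff (W i) l) (monom 1 l))"
      using W[OF True] by (subst poly_eq_sum_monom[of m "W i"]) auto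
    thus ?thesis using True
      by (simp add: sum_lessThan_add A_def B_def sum_distrib_left mult.commute[of G])
  next
    case False
    have "(\<Sum>l<m + N. smult (A i l) (B l)) = (\<Sum>l<m + N. if i = l then B l else 0)"
      using False by (intro sum.cong) (auto simp: A_def)
    thus ?thesis using False that by (simp add: B_def)
  qed
  have "fdet (m + N) (\<lambda>i. coeff (if i < m then G * W i else monom 1 i))
      = fdet (m + N) A * fdet (m + N) (\<lambda>l. coeff (B l))"
    unfolding fdet_mult by (intro fdet_cong) (simp add: expand coeff_sum)
  also have "fdet (m + N) (\<lambda>l. coeff (B l)) = (\<Prod>l<m + N. coeff (B l) l)"
    by (rule fdet_upper_triangular) (auto simp: B_def coeff_monom_mult)
  also have "\<dots> = coeff G 0 ^ m"
  proof -
    have "(\<Prod>l<m + N. coeff (B l) l) = (\<Prod>l\<in>{..<m}. coeff (B l) l)"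
      by (rule prod.mono_neutral_right) (auto simp: B_def)
    also have "\<dots> = (\<Prod>l<m. coeff G 0)"
      by (intro prod.cong) (auto simp: B_def coeff_monom_mult)
    finally show ?thesis by simp
  qed
  also have "fdet (m + N) A = fdet m A * fdet N (\<lambda>i j. A (m + i) (m + j))"
    by (rule fdet_block_lower) (auto simp: A_def)
  also have "fdet m A = fdet m (\<lambda>i. coeff (W i))"
    by (rule fdet_cong) (auto simp: A_def)
  also have "fdet N (\<lambda>i j. A (m + i) (m + j)) = 1"
    by (subst fdet_lower_triangular) (auto simp: A_def)
  finally show ?thesis by simp
qed

text \<open>The classes of \<open>g 0, \<dots>, g (k + m - 1)\<close> modulo \<open>x ^ m * p\<close>: the first \<open>k\<close> are independent modulo \<open>p\<close>, and
  the others are multiples of \<open>p\<close> after row operations with the first ones, which leaves their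
  quotients by \<open>p\<close> to be reduced modulo \<open>x ^ m\<close>.\<close>

lemma fdet_christoffel:
  fixes p :: "'a::idom poly"
  assumes p: "degree p = k" "coeff p k = 1"
    and deg: "\<And>i. i < k + m \<Longrightarrow> degree (g i) < k + m + N"
    and dvd: "\<And>i. i < k \<Longrightarrow> p dvd g i - \<rho> i"
    and \<rho>: "\<And>i j. i < k \<Longrightarrow> k \<le> j \<Longrightarrow> coeff (\<rho> i) j = 0"
    and g: "\<And>b. b < m \<Longrightarrow> g (k + b) = p * (G * W b) + (\<Sum>l<k. smult (E b l) (g l))"
    and W: "\<And>b j. b < m \<Longrightarrow> m \<le> j \<Longrightarrow> coeff (W b) j = 0"
  shows "fdet (k + m + N) (\<lambda>i. coeff (if i < k + m then g i else monom 1 (i - k) * p))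
    = fdet k (\<lambda>i. coeff (\<rho> i)) * coeff G 0 ^ m * fdet m (\<lambda>i. coeff (W i))"
proof -
  define h where "h = (\<lambda>b. if b < m then G * W b else monom 1 b)"
  define f where "f = (\<lambda>i. if i < k then g i else p * h (i - k))"
  have "fdet (k + (m + N)) (\<lambda>i. coeff (if i < k + m then g i else monom 1 (i - k) * p))
      = fdet (k + (m + N)) (\<lambda>i j. if i < k then coeff (f i) j else coeff (f i) j
          + (\<Sum>l<k. (if i < k + m then E (i - k) l else 0) * coeff (f l) j))"
  proof (intro fdet_cong)
    fix i j assume "i < k + (m + N)" "j < k + (m + N)"
    show "coeff (if i < k + m then g i else monom 1 (i - k) * p) j
      = (if i < k then coeff (f i) j else coeff (f i) j
          + (\<Sum>l<k. (if i < k + m then E (i - k) l else 0) * coeff (f l) j))"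
      using g[of "i - k"] by (auto simp: f_def h_def coeff_sum mult.commute)
  qed
  also have "\<dots> = fdet (k + (m + N)) (\<lambda>i. coeff (f i))" by (rule fdet_add_initial_rows)
  also have "\<dots> = fdet k (\<lambda>i. coeff (\<rho> i)) * fdet (m + N) (\<lambda>i. coeff (h i))"
  proof (rule fdet_coeff_mod[OF p])
    fix i assume i: "i < k + (m + N)"
    consider "i < k" | "k \<le> i" "i < k + m" | "k + m \<le> i" by linarith
    thus "degree (f i) < k + (m + N)"
    proof cases
      case 1
      thus ?thesis using deg[of i] by (simp add: f_def)
    next
      case 2
      have "degree (\<Sum>l<k. smult (E (i - k) l) (g l)) < k + (m + N)"
        using i deg
        by (intro degree_sum_less) (auto intro!: le_less_trans[OF degree_smult_le] simp: add.assoc)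
      hence "degree (g i - (\<Sum>l<k. smult (E (i - k) l) (g l))) < k + (m + N)"
        using deg[of i] 2 by (intro degree_diff_less) auto
      also have "g i - (\<Sum>l<k. smult (E (i - k) l) (g l)) = f i"
        using 2 g[of "i - k"] by (auto simp: f_def h_def)
      finally show ?thesis .
    next
      case 3
      have "degree (p * monom 1 (i - k)) \<le> k + (i - k)"
        using degree_mult_le[of p "monom 1 (i - k)"] degree_monom_le[of "1::'a" "i - k"] p by simp
      thus ?thesis using 3 i by (auto simp: f_def h_def)
    qed
  qed (auto simp: f_def dvd \<rho>)
  also have "fdet (m + N) (\<lambda>i. coeff (h i)) = coeff G 0 ^ m * fdet m (\<lambda>i. coeff (W i))"
    unfolding h_def by (rule fdet_coeff_mod_power[OF W])
  finally show ?thesis by (simp add: add.assoc mult.assoc)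
qed

section \<open>Lucas sequences\<close>

text \<open>For \<open>y = z + 1/z\<close> these are \<open>(z\<^sup>n - z\<^bsup>-n\<^esup>) / (z - z\<^bsup>-1\<^esup>)\<close> and \<open>z\<^sup>n + z\<^bsup>-n\<^esup>\<close>. They are taken over an arbitrary
  ring because they are needed both at the polynomial \<open>x - c\<close> and at the scalar \<open>c\<close>.\<close>

fun lucU :: "'a::comm_ring_1 \<Rightarrow> nat \<Rightarrow> 'a" where
  "lucU y 0 = 0"
| "lucU y (Suc 0) = 1"
| "lucU y (Suc (Suc n)) = y * lucU y (Suc n) - lucU y n"

fun lucV :: "'a::comm_ring_1 \<Rightarrow> nat \<Rightarrow> 'a" where
  "lucV y 0 = 2"
| "lucV y (Suc 0) = y"
| "lucV y (Suc (Suc n)) = y * lucV y (Suc n) - lucV y n"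

text \<open>The Chebyshev polynomials of the third and fourth kind, in the normalisation \<open>y = 2 cos \<theta>\<close>:
  \<open>(z\<^bsup>n+1/2\<^esup> \<plusminus> z\<^bsup>-n-1/2\<^esup>) / (z\<^bsup>1/2\<^esup> \<plusminus> z\<^bsup>-1/2\<^esup>)\<close>.\<close>

definition cheb3 :: "'a::comm_ring_1 \<Rightarrow> nat \<Rightarrow> 'a" where
  "cheb3 y n = lucU y (Suc n) - lucU y n"

definition cheb4 :: "'a::comm_ring_1 \<Rightarrow> nat \<Rightarrow> 'a" where
  "cheb4 y n = lucU y (Suc n) + lucU y n"

lemma cheb3_simps [simp]:
  "cheb3 y 0 = 1" "cheb3 y (Suc 0) = y - 1"
  "cheb3 y (Suc (Suc n)) = y * cheb3 y (Suc n) - cheb3 y n"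
  by (auto simp: cheb3_def algebra_simps)

lemma cheb4_simps [simp]:
  "cheb4 y 0 = 1" "cheb4 y (Suc 0) = y + 1"
  "cheb4 y (Suc (Suc n)) = y * cheb4 y (Suc n) - cheb4 y n"
  by (auto simp: cheb4_def algebra_simps)

text \<open>Pairs of indices that are symmetric about the centre \<open>i + b\<close>: each of the two mirror identities
  expands a product of expressions in \<open>z\<close>, and its two sides satisfy the same recursion.\<close>

lemma cheb3_add_mirror: "cheb3 y (i + 2 * b) + cheb3 y i = cheb3 y (i + b) * lucV y b"
proof (induction y b arbitrary: i rule: lucV.induct)
  case (3 y b)
  have "cheb3 y (i + 2 * Suc (Suc b)) + cheb3 y i
      = y * (cheb3 y (Suc i + 2 * Suc b) + cheb3 y (Suc i))
        - (cheb3 y (Suc (Suc i) + 2 * b) + cheb3 y (Suc (Suc i)))"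
    by (simp add: algebra_simps)
  also have "\<dots> = cheb3 y (i + Suc (Suc b)) * lucV y (Suc (Suc b))"
    unfolding 3 by (simp add: algebra_simps)
  finally show ?case .
qed (auto simp: algebra_simps)

lemma cheb3_diff_mirror:
  "cheb3 y (i + 2 * a + 1) - cheb3 y i = lucU y (i + a + 1) * (y - 2) * cheb4 y a"
proof (induction a arbitrary: i rule: induct_nat_012)
  case 0
  show ?case by (simp add: cheb3_def algebra_simps)
next
  case 1
  show ?case by (simp add: cheb3_def numeral_eq_Suc algebra_simps)
next
  case (ge2 a)
  have "cheb3 y (i + 2 * Suc (Suc a) + 1) - cheb3 y i
      = y * (cheb3 y (Suc i + 2 * Suc a + 1) - cheb3 y (Suc i))
        - (cheb3 y (Suc (Suc i) + 2 * a + 1) - cheb3 y (Suc (Suc i)))"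
    by (simp add: algebra_simps)
  also have "\<dots> = lucU y (i + Suc (Suc a) + 1) * (y - 2) * cheb4 y (Suc (Suc a))"
    unfolding ge2 by (simp add: algebra_simps)
  finally show ?case .
qed

text \<open>The mirror identity with centre \<open>k\<close> and distance \<open>a + k + 1\<close>: the mirror image of the index
  \<open>a + 2 k + 1\<close> is \<open>- a - 1\<close>, where the sequence takes its value at \<open>a\<close>.\<close>

lemma cheb3_antiperiod:
  "cheb3 y (a + (2 * k + 1)) + cheb3 y a = cheb3 y k * lucV y (a + k + 1)"
proof (induction a rule: induct_nat_012)
  have k: "cheb3 y (2 * k) + 1 = cheb3 y k * lucV y k" using cheb3_add_mirror[of y 0 k] by simp
  show zero: "cheb3 y (0 + (2 * k + 1)) + cheb3 y 0 = cheb3 y k * lucV y (0 + k + 1)"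
  proof (cases k)
    case (Suc l)
    have "cheb3 y (Suc (2 * l)) + (y - 1) = cheb3 y k * lucV y l"
      using cheb3_add_mirror[of y 1 l] Suc by simp
    hence "y * (cheb3 y (2 * k) + 1) - (cheb3 y (Suc (2 * l)) + (y - 1))
        = cheb3 y k * lucV y (Suc k)"
      unfolding k using Suc by (simp add: algebra_simps)
    thus ?thesis using Suc by (simp add: algebra_simps)
  qed simp
  have "y * (cheb3 y (Suc (2 * k)) + 1) - (cheb3 y (2 * k) + 1)
      = cheb3 y k * lucV y (Suc (Suc k))"
    unfolding k using zero by (simp add: algebra_simps)
  thus "cheb3 y (Suc 0 + (2 * k + 1)) + cheb3 y (Suc 0) = cheb3 y k * lucV y (Suc 0 + k + 1)"
    by (simp add: algebra_simps)
next
  case (ge2 a)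
  have "y * (cheb3 y (Suc a + (2 * k + 1)) + cheb3 y (Suc a))
        - (cheb3 y (a + (2 * k + 1)) + cheb3 y a)
      = cheb3 y k * lucV y (Suc (Suc a) + k + 1)"
    unfolding ge2 by (simp add: algebra_simps)
  thus ?case by (simp add: algebra_simps)
qed

lemma cheb3_dvd_antiperiod: "cheb3 y k dvd cheb3 y ((2 * k + 1) * n + a) - (-1) ^ n * cheb3 y a"
proof (induction n)
  case (Suc n)
  have eq: "(2 * k + 1) * Suc n + a = (2 * k + 1) * n + a + (2 * k + 1)" by simp
  have "cheb3 y k dvd cheb3 y ((2 * k + 1) * Suc n + a) + cheb3 y ((2 * k + 1) * n + a)"
    unfolding eq cheb3_antiperiod by simp
  from dvd_diff[OF this Suc] show ?case by (simp add: algebra_simps)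
qed simp

lemma lucU_add: "lucU y (a + b + 1) = lucU y (a + 1) * lucU y (b + 1) - lucU y a * lucU y b"
proof (induction b rule: induct_nat_012)
  case (ge2 b)
  have "lucU y (a + Suc (Suc b) + 1) = y * lucU y (a + Suc b + 1) - lucU y (a + b + 1)"
    by simp
  also have "\<dots> = lucU y (a + 1) * lucU y (Suc (Suc b) + 1) - lucU y a * lucU y (Suc (Suc b))"
    unfolding ge2 by (simp add: algebra_simps)
  finally show ?case .
qed auto

lemma lucU_sub: "lucU y (j + k) * lucU y (k + 1) - lucU y (j + k + 1) * lucU y k = lucU y j"
proof (induction k)
  case (Suc k)
  have "lucU y (j + Suc k) * lucU y (Suc k + 1) - lucU y (j + Suc k + 1) * lucU y (Suc k)
      = lucU y (j + k) * lucU y (k + 1) - lucU y (j + k + 1) * lucU y k"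
    by (simp add: algebra_simps)
  thus ?case using Suc by simp
qed simp

text \<open>For \<open>j = 0\<close> this is the factorisation of \<open>lucU y (2 * k + 1)\<close>.\<close>

lemma cheb4_mult_cheb3: "cheb4 y (j + k) * cheb3 y k = lucU y j + lucU y (j + (2 * k + 1))"
proof -
  have "j + k + k + 1 = j + (2 * k + 1)" by simp
  hence "lucU y (j + (2 * k + 1))
      = lucU y (j + k + 1) * lucU y (k + 1) - lucU y (j + k) * lucU y k"
    using lucU_add[of y "j + k" k] by (simp only:)
  thus ?thesis
    unfolding lucU_sub[of y j k, symmetric] by (simp add: cheb3_def cheb4_def algebra_simps)
qed

lemma lucU_dvd: "lucU y a dvd lucU y (a * n)"
proof (cases a)
  case (Suc a')
  show ?thesis
  proof (induction n)
    case (Suc n)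
    have "a * Suc n = a * n + a' + 1" using \<open>a = Suc a'\<close> by simp
    hence "lucU y (a * Suc n) = lucU y (a * n + 1) * lucU y a - lucU y (a * n) * lucU y a'"
      using lucU_add[of y "a * n" a'] \<open>a = Suc a'\<close> by (simp only: Suc_eq_plus1)
    thus ?case using Suc by simp
  qed simp
qed simp

lemma lucU_minus: "lucU (- y) n = (-1) ^ Suc n * lucU y n"
  by (induction n rule: induct_nat_012) (auto simp: algebra_simps)

lemma cheb3_minus: "cheb3 (- y) n = (-1) ^ n * cheb4 y n"
  by (simp add: cheb3_def cheb4_def lucU_minus algebra_simps)

lemma lucV_add_Suc: "lucV y (Suc n) + lucV y n = (y + 2) * cheb3 y n"
proof (induction n rule: induct_nat_012)
  case (ge2 n)
  have "lucV y (Suc (Suc (Suc n))) + lucV y (Suc (Suc n))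
     = y * (lucV y (Suc (Suc n)) + lucV y (Suc n)) - (lucV y (Suc n) + lucV y n)"
    by (simp add: algebra_simps)
  also have "\<dots> = (y + 2) * cheb3 y (Suc (Suc n))"
    unfolding ge2 by (simp add: algebra_simps)
  finally show ?case .
qed (auto simp: algebra_simps)

lemma poly_lucU: "poly (lucU f n) x = lucU (poly f x) n"
  by (induction n rule: induct_nat_012) auto

lemma poly_cheb3: "poly (cheb3 f n) x = cheb3 (poly f x) n"
  by (simp add: cheb3_def poly_lucU)

text \<open>The value at \<open>0\<close> only has to be a constant, not \<open>1\<close>; this covers \<open>lucV\<close>.\<close>

lemma coeff_three_term:
  fixes f :: "nat \<Rightarrow> 'a::comm_ring_1 poly"
  assumes "\<And>j. 0 < j \<Longrightarrow> coeff (f 0) j = 0"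
    and "coeff (f 1) 1 = 1" "\<And>j. 1 < j \<Longrightarrow> coeff (f 1) j = 0"
    and "\<And>n. f (Suc (Suc n)) = [:- c, 1:] * f (Suc n) - f n"
  shows "0 < n \<Longrightarrow> coeff (f n) n = 1" "n < j \<Longrightarrow> coeff (f n) j = 0"
proof (induction n arbitrary: j rule: induct_nat_012)
  case (ge2 n)
  {
    case 1
    show ?case using ge2 by (simp add: assms(4)[of n])
  next
    case 2
    then obtain i where "j = Suc i" by (cases j) auto
    with 2 ge2 show ?case by (simp add: assms(4)[of n])
  }
qed (use assms(1-3) in auto)

lemma ops_eq_cheb3: "ops (\<lambda>k. if k = 0 then 1 + c else c) n = cheb3 [:- c, 1:] n"
  by (induction n rule: induct_nat_012) (auto simp: one_pCons)


section \<open>The four families of Hankel determinants\<close>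

definition graded_monic :: "(nat \<Rightarrow> 'a::comm_ring_1 poly) \<Rightarrow> bool" where
  "graded_monic f \<longleftrightarrow> (\<forall>i. coeff (f i) i = 1 \<and> (\<forall>j>i. coeff (f i) j = 0))"

lemma fdet_graded_monic: "graded_monic f \<Longrightarrow> fdet n (\<lambda>i. coeff (f i)) = 1"
  by (subst fdet_lower_triangular) (auto simp: graded_monic_def)

lemma fdet_graded_monic_reverse:
  "graded_monic f \<Longrightarrow> fdet n (\<lambda>i. coeff (f (n - 1 - i))) = (-1) ^ (n choose 2)"
  using fdet_reverse_rows[of n "\<lambda>i. coeff (f i)"] by (simp add: fdet_graded_monic)

lemma graded_monic_cheb3: "graded_monic (cheb3 [:- c, 1:])"
  unfolding graded_monic_def ops_eq_cheb3[symmetric] by (simp add: coeff_ops)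

lemma degree_cheb3: "degree (cheb3 [:- c, 1:] n) = n"
  unfolding ops_eq_cheb3[symmetric] by (rule degree_ops)

lemma graded_monic_cheb4: "graded_monic (cheb4 [:- c, 1:])"
proof -
  have "coeff (cheb4 [:- c, 1:] n) n = 1 \<and> (\<forall>j>n. coeff (cheb4 [:- c, 1:] n) j = 0)" for n
    using coeff_three_term[of "cheb4 [:- c, 1:]" c n]
    by (cases "n = 0") (auto simp: coeff_pCons split: nat.splits)
  thus ?thesis by (simp add: graded_monic_def)
qed

text \<open>At the centre itself the mirror pair collapses to one polynomial, so the factor \<open>lucV y 0 = 2\<close>
  has to be replaced by \<open>1\<close>.\<close>

definition lucV' :: "'a::comm_ring_1 \<Rightarrow> nat \<Rightarrow> 'a" where
  "lucV' y b = (if b = 0 then 1 else lucV y b)"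

lemma graded_monic_lucV': "graded_monic (lucV' [:- c, 1:])"
proof -
  have two: "coeff (2 :: 'a poly) j = 0" if "0 < j" for j
    using that by (simp add: numeral_poly coeff_pCons split: nat.splits)
  have "coeff (lucV' [:- c, 1:] n) n = 1 \<and> (\<forall>j>n. coeff (lucV' [:- c, 1:] n) j = 0)" for n
    using coeff_three_term[of "lucV [:- c, 1:]" c n]
    by (cases "n = 0") (auto simp: coeff_pCons two lucV'_def split: nat.splits)
  thus ?thesis by (simp add: graded_monic_def)
qed

definition cat_hankel :: "'a::comm_ring_1 \<Rightarrow> nat \<Rightarrow> nat \<Rightarrow> nat \<Rightarrow> 'a" where
  "cat_hankel c N m k = fdet N (\<lambda>i j. Cat_bc 1 c (i + j + m) k)"

lemma cat_hankel_eq: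
  fixes c :: "'a::idom"
  shows "cat_hankel c N m k = (-1) ^ (N * (k + m)) * fdet (k + m + N)
    (\<lambda>i. coeff (if i < k + m then cheb3 [:- c, 1:] (N + i) else monom 1 (i - k) * cheb3 [:- c, 1:] k))"
proof -
  have "cat_hankel c N m k = fdet (N + (k + m))
     (\<lambda>i. coeff (if i < N then monom 1 (m + i) * cheb3 [:- c, 1:] k else cheb3 [:- c, 1:] i))"
    unfolding cat_hankel_def Cat_bc_def hankel_det_Cat ops_eq_cheb3 ..
  also have "\<dots> = (-1) ^ (N * (k + m)) * fdet (N + (k + m)) (\<lambda>i. coeff (if i < k + m
      then cheb3 [:- c, 1:] (N + i) else monom 1 (i - k) * cheb3 [:- c, 1:] k))"
    by (subst fdet_swap_blocks[of N "k + m"])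
       (auto intro!: arg_cong2[of _ _ _ _ times] fdet_cong simp: add.commute)
  finally show ?thesis by (simp add: add.commute)
qed

text \<open>The form for windows that begin with the \<open>m\<close> polynomials to be eliminated and end with the \<open>k\<close>
  polynomials that represent the residues modulo \<open>cheb3 [:- c, 1:] k\<close>.\<close>

lemma cat_hankel_eq_swapped:
  fixes c :: "'a::idom"
  shows "cat_hankel c N m k = (-1) ^ (N * (k + m) + m * k) * fdet (k + m + N)
    (\<lambda>i. coeff (if i < k + m
       then if i < k then cheb3 [:- c, 1:] (N + m + i) else cheb3 [:- c, 1:] (N + (i - k))
       else monom 1 (i - k) * cheb3 [:- c, 1:] k))"
  unfolding cat_hankel_eq power_add mult.assoc
  by (subst fdet_swap_blocks[of m k])
     (auto intro!: arg_cong2[of _ _ _ _ times] fdet_cong simp: add_ac)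

lemma smult_minus_one_power: "smult ((-1) ^ n) f = (-1) ^ n * (f :: 'a::comm_ring_1 poly)"
  by (cases "even n") auto

text \<open>Residues modulo \<open>cheb3 f k\<close> of the \<open>k\<close> polynomials that follow a boundary: they reproduce
  \<open>cheb3 f 0, \<dots>, cheb3 f (k - 1)\<close> up to a common sign.\<close>

lemma cheb3_dvd_forward:
  "cheb3 f k dvd cheb3 f ((2 * k + 1) * n + a) - smult ((-1) ^ n) (cheb3 f a)"
  unfolding smult_minus_one_power by (rule cheb3_dvd_antiperiod)

lemma cheb3_dvd_center: "cheb3 y k dvd cheb3 y ((2 * k + 1) * n + k)"
  using dvd_add[OF cheb3_dvd_antiperiod[of y k n k] dvd_triv_right[of "cheb3 y k" "(-1) ^ n"]]
  by simp

text \<open>Residues of the \<open>k\<close> polynomials that follow a centre: by antisymmetry about the centre they run through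
  the same list backwards.\<close>

lemma cheb3_dvd_backward:
  assumes "i < k"
  shows "cheb3 f k dvd cheb3 f ((2 * k + 1) * n + (k + 1 + i))
           - smult ((-1) ^ (n + 1)) (cheb3 f (k - 1 - i))"
proof -
  let ?N = "(2 * k + 1) * n"
  have idx: "?N + (k + 1 + i) = ?N + (k - 1 - i) + 2 * (i + 1)"
    "?N + k = ?N + (k - 1 - i) + (i + 1)"
    using assms by auto
  have "cheb3 f k dvd cheb3 f (?N + (k + 1 + i)) + cheb3 f (?N + (k - 1 - i))"
    unfolding idx(1) cheb3_add_mirror idx(2)[symmetric]
    using cheb3_dvd_center by (rule dvd_mult2)
  from dvd_diff[OF this cheb3_dvd_forward[of f k n "k - 1 - i"]] show ?thesis by simp
qed

lemma graded_monicD: "graded_monic f \<Longrightarrow> i < j \<Longrightarrow> coeff (f i) j = 0"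
  by (simp add: graded_monic_def)

lemma graded_monic_same: "graded_monic f \<Longrightarrow> coeff (f i) i = 1"
  by (simp add: graded_monic_def)

lemmas graded_monic_simps =
  graded_monicD[OF graded_monic_cheb3] graded_monic_same[OF graded_monic_cheb3]
  graded_monicD[OF graded_monic_cheb4] graded_monicD[OF graded_monic_lucV']

text \<open>The window starts at a boundary. Its first \<open>k\<close> members are the residues; the next \<open>m\<close> start at the
  centre and are reflected back into the first \<open>k\<close>, which is where \<open>m \<le> k + 1\<close> enters.\<close>

lemma cat_hankel_r_zero:
  fixes c :: "'a::idom"
  assumes N: "N = (2 * k + 1) * n" and m: "m \<le> k + 1"
    and G: "cheb3 [:- c, 1:] (N + k) = cheb3 [:- c, 1:] k * G"
  shows "cat_hankel c N m k = (-1) ^ (N * (k + m) + n * k) * coeff G 0 ^ m"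
proof -
  let ?p = "cheb3 [:- c, 1:]"
  have "fdet (k + m + N) (\<lambda>i. coeff (if i < k + m then ?p (N + i) else monom 1 (i - k) * ?p k))
    = fdet k (\<lambda>i. coeff (smult ((-1) ^ n) (?p i))) * coeff G 0 ^ m
      * fdet m (\<lambda>i. coeff (lucV' [:- c, 1:] i))"
  proof (rule fdet_christoffel)
    fix b assume b: "b < m"
    show "?p (N + (k + b)) = ?p k * (G * lucV' [:- c, 1:] b)
      + (\<Sum>l<k. smult (if 0 < b \<and> l = k - b then - 1 else 0) (?p (N + l)))"
    proof (cases "b = 0")
      case True
      thus ?thesis using G by (simp add: lucV'_def)
    next
      case False
      with b m have "b \<le> k" by simp
      have "?p (N + (k + b)) + ?p (N + (k - b)) = ?p (N + k) * lucV [:- c, 1:] b"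
        using cheb3_add_mirror[of "[:- c, 1:]" "N + (k - b)" b] \<open>b \<le> k\<close> by (simp add: mult_2)
      moreover have "(\<Sum>l<k. smult (if 0 < b \<and> l = k - b then - 1 else 0) (?p (N + l)))
          = (\<Sum>l<k. if l = k - b then - ?p (N + l) else 0)"
        using False by (intro sum.cong) auto
      ultimately show ?thesis using False \<open>b \<le> k\<close>
        by (simp add: lucV'_def G algebra_simps)
    qed
  qed (use cheb3_dvd_forward in \<open>auto simp: degree_cheb3 graded_monic_simps N\<close>)
  thus ?thesis
    by (simp only: cat_hankel_eq fdet_coeff_smult fdet_graded_monic graded_monic_cheb3
        graded_monic_lucV' mult_1_right mult_1_left
        flip: power_mult) (simp only: power_add mult_ac)
qed

text \<open>The window ends just before a boundary. Its last \<open>k\<close> members are the residues, and the \<open>m\<close> members up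
  to and including the centre are reflected forwards, in the order of decreasing distance to the centre.\<close>

lemma cat_hankel_r_low:
  fixes c :: "'a::idom"
  assumes N: "N = (2 * k + 1) * n + (k + 1 - m)" and m: "m \<le> k + 1"
    and G: "cheb3 [:- c, 1:] ((2 * k + 1) * n + k) = cheb3 [:- c, 1:] k * G"
  shows "cat_hankel c N m k = 
    (-1) ^ (N * (k + m) + m * k + (n + 1) * k + (k choose 2) + (m choose 2)) * coeff G 0 ^ m"
proof -
  let ?p = "cheb3 [:- c, 1:]"
  let ?M = "(2 * k + 1) * n"
  have Nm: "N + m = ?M + (k + 1)" using N m by simp
  have "fdet (k + m + N) (\<lambda>i. coeff (if i < k + m
       then if i < k then ?p (N + m + i) else ?p (N + (i - k)) else monom 1 (i - k) * ?p k))
    = fdet k (\<lambda>i. coeff (smult ((-1) ^ (n + 1)) (?p (k - 1 - i)))) * coeff G 0 ^ m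
      * fdet m (\<lambda>i. coeff (lucV' [:- c, 1:] (m - 1 - i)))"
  proof (rule fdet_christoffel)
    fix b assume b: "b < m"
    \<comment> \<open>the distance to the centre\<close>
    define b' where "b' = m - 1 - b"
    have b': "b' \<le> k" "N + b = ?M + (k - b')" using b m N by (auto simp: b'_def)
    have "?p (N + b) = ?p k * (G * lucV' [:- c, 1:] b')
      + (\<Sum>l<k. smult (if 0 < b' \<and> l = b' - 1 then - 1 else 0) (?p (N + m + l)))"
    proof (cases "b' = 0")
      case True
      thus ?thesis using G b' by (simp add: lucV'_def)
    next
      case False
      have idx: "?M + (k - b') + 2 * b' = ?M + (k + b')" "?M + (k - b') + b' = ?M + k"
        using b' by auto
      have "?p (?M + (k + b')) + ?p (?M + (k - b')) = ?p (?M + k) * lucV [:- c, 1:] b'"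
        using cheb3_add_mirror[of "[:- c, 1:]" "?M + (k - b')" b'] unfolding idx .
      hence "?p (N + b) = ?p k * (G * lucV [:- c, 1:] b') - ?p (?M + (k + b'))"
        unfolding b'(2) G by (simp only: algebra_simps)
      moreover have "(\<Sum>l<k. smult (if 0 < b' \<and> l = b' - 1 then - 1 else 0) (?p (N + m + l)))
          = (\<Sum>l<k. if l = b' - 1 then - ?p (N + m + l) else 0)"
        using False by (intro sum.cong) auto
      moreover have "N + m + (b' - 1) = ?M + (k + b')" using False Nm by simp
      moreover have "b' - 1 < k" using False b' by simp
      ultimately show ?thesis using False by (simp add: lucV'_def)
    qed
    thus "(if k + b < k then ?p (N + m + (k + b)) else ?p (N + (k + b - k)))
      = ?p k * (G * lucV' [:- c, 1:] (m - 1 - b))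
      + (\<Sum>l<k. smult (if 0 < m - 1 - b \<and> l = m - 1 - b - 1 then - 1 else 0)
           (if l < k then ?p (N + m + l) else ?p (N + (l - k))))"
      by (simp add: b'_def)
  next
    fix i assume "i < k"
    from cheb3_dvd_backward[OF this, of "[:- c, 1:]" n]
    show "?p k dvd (if i < k then ?p (N + m + i) else ?p (N + (i - k)))
        - smult ((-1) ^ (n + 1)) (?p (k - 1 - i))"
      using \<open>i < k\<close> by (simp add: Nm add.assoc)
  qed (auto simp: degree_cheb3 graded_monic_simps)
  thus ?thesis
    by (simp only: cat_hankel_eq_swapped fdet_coeff_smult fdet_graded_monic_reverse
        graded_monic_cheb3 graded_monic_lucV' mult_1_right mult_1_left
        flip: power_mult) (simp only: power_add mult_ac)
qed

text \<open>The window starts just after a centre. The \<open>m\<close> members that follow the next boundary are reflected back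
  into the first \<open>k\<close>.\<close>

lemma cat_hankel_r_middle:
  fixes c :: "'a::idom"
  assumes N: "N = (2 * k + 1) * n + (k + 1)" and m: "m \<le> k"
    and G: "lucU [:- c, 1:] ((2 * k + 1) * (n + 1)) * ([:- c, 1:] - 2) = cheb3 [:- c, 1:] k * G"
  shows "cat_hankel c N m k = 
    (-1) ^ (N * (k + m) + (n + 1) * k + (k choose 2)) * coeff G 0 ^ m"
proof -
  let ?p = "cheb3 [:- c, 1:]"
  have "fdet (k + m + N) (\<lambda>i. coeff (if i < k + m then ?p (N + i) else monom 1 (i - k) * ?p k))
    = fdet k (\<lambda>i. coeff (smult ((-1) ^ (n + 1)) (?p (k - 1 - i)))) * coeff G 0 ^ m
      * fdet m (\<lambda>i. coeff (cheb4 [:- c, 1:] i))"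
  proof (rule fdet_christoffel)
    fix b assume b: "b < m"
    have idx: "N + (k - 1 - b) + 2 * b + 1 = N + (k + b)"
      "N + (k - 1 - b) + b + 1 = (2 * k + 1) * (n + 1)"
      using b m N by auto
    have "?p (N + (k + b)) - ?p (N + (k - 1 - b)) = ?p k * G * cheb4 [:- c, 1:] b"
      using cheb3_diff_mirror[of "[:- c, 1:]" "N + (k - 1 - b)" b] unfolding idx G .
    moreover have "(\<Sum>l<k. smult (if l = k - 1 - b then 1 else 0) (?p (N + l)))
        = (\<Sum>l<k. if l = k - 1 - b then ?p (N + l) else 0)"
      by (intro sum.cong) auto
    ultimately show "?p (N + (k + b)) = ?p k * (G * cheb4 [:- c, 1:] b)
      + (\<Sum>l<k. smult (if l = k - 1 - b then 1 else 0) (?p (N + l)))"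
      using b m by (simp add: algebra_simps)
  next
    fix i assume "i < k"
    from cheb3_dvd_backward[OF this, of "[:- c, 1:]" n]
    show "?p k dvd ?p (N + i) - smult ((-1) ^ (n + 1)) (?p (k - 1 - i))"
      by (simp add: N add.assoc)
  qed (auto simp: degree_cheb3 graded_monic_simps)
  thus ?thesis
    by (simp only: cat_hankel_eq fdet_coeff_smult fdet_graded_monic fdet_graded_monic_reverse
        graded_monic_cheb3 graded_monic_cheb4 mult_1_right mult_1_left
        flip: power_mult) (simp only: power_add mult_ac)
qed

text \<open>The window ends just before a centre. The \<open>m\<close> members before the boundary are reflected forwards into the last
  \<open>k\<close>; compared with the reflection in the other direction, \<open>G\<close> changes its sign.\<close>

lemma cat_hankel_r_high:
  fixes c :: "'a::idom"
  assumes N: "N = (2 * k + 1) * n + (2 * k + 1 - m)" and m: "m \<le> k"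
    and G: "lucU [:- c, 1:] ((2 * k + 1) * (n + 1)) * ([:- c, 1:] - 2) = cheb3 [:- c, 1:] k * G"
  shows "cat_hankel c N m k = 
    (-1) ^ (N * (k + m) + m * k + (n + 1) * k + (m choose 2) + m) * coeff G 0 ^ m"
proof -
  let ?p = "cheb3 [:- c, 1:]"
  let ?M = "(2 * k + 1) * (n + 1)"
  have Nm: "N + m = ?M" using N m by simp
  have "fdet (k + m + N) (\<lambda>i. coeff (if i < k + m
       then if i < k then ?p (N + m + i) else ?p (N + (i - k)) else monom 1 (i - k) * ?p k))
    = fdet k (\<lambda>i. coeff (smult ((-1) ^ (n + 1)) (?p i))) * coeff (- G) 0 ^ m
      * fdet m (\<lambda>i. coeff (cheb4 [:- c, 1:] (m - 1 - i)))"
  proof (rule fdet_christoffel)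
    fix b assume b: "b < m"
    define b' where "b' = m - 1 - b"
    have b': "b' < k" "N + b + 2 * b' + 1 = N + m + b'" "N + b + b' + 1 = ?M"
      using b m Nm by (auto simp: b'_def)
    have "?p (N + m + b') - ?p (N + b) = ?p k * G * cheb4 [:- c, 1:] b'"
      using cheb3_diff_mirror[of "[:- c, 1:]" "N + b" b'] unfolding b' G .
    moreover have "(\<Sum>l<k. smult (if l = b' then 1 else 0) (?p (N + m + l)))
        = (\<Sum>l<k. if l = b' then ?p (N + m + l) else 0)"
      by (intro sum.cong) auto
    ultimately have "?p (N + b) = ?p k * (- G * cheb4 [:- c, 1:] b')
      + (\<Sum>l<k. smult (if l = b' then 1 else 0) (?p (N + m + l)))"
      using b' by (simp add: algebra_simps)
    thus "(if k + b < k then ?p (N + m + (k + b)) else ?p (N + (k + b - k)))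
      = ?p k * (- G * cheb4 [:- c, 1:] (m - 1 - b))
      + (\<Sum>l<k. smult (if l = m - 1 - b then 1 else 0)
           (if l < k then ?p (N + m + l) else ?p (N + (l - k))))"
      by (simp add: b'_def)
  next
    fix i assume "i < k"
    with cheb3_dvd_forward[of "[:- c, 1:]" k "n + 1" i]
    show "?p k dvd (if i < k then ?p (N + m + i) else ?p (N + (i - k)))
        - smult ((-1) ^ (n + 1)) (?p i)"
      by (simp only: Nm if_True)
  qed (auto simp: degree_cheb3 graded_monic_simps)
  moreover have "(- coeff G 0) ^ m = (-1) ^ m * coeff G 0 ^ m" by (rule power_minus)
  ultimately show ?thesis
    by (simp only: cat_hankel_eq_swapped fdet_coeff_smult fdet_graded_monic
        fdet_graded_monic_reverse graded_monic_cheb3 graded_monic_cheb4 coeff_minus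
        mult_1_right mult_1_left flip: power_mult) (simp only: power_add mult_ac)
qed

section \<open>Evaluation at zero\<close>

text \<open>At \<open>x = 0\<close> the third kind at \<open>-c\<close> becomes the fourth kind at \<open>c\<close>. The factor
  \<open>cheb4 c k\<close> in front of \<open>coeff G 0\<close> is completed by \<open>cheb3 c k\<close> to \<open>lucU c (2 * k + 1)\<close>.\<close>

lemma coeff_0_center_quotient:
  fixes c :: "'a::idom"
  assumes G: "cheb3 [:- c, 1:] ((2 * k + 1) * n + k) = cheb3 [:- c, 1:] k * G"
  shows "lucU c (2 * k + 1) * coeff G 0
    = (-1) ^ n * (lucU c ((2 * k + 1) * n) + lucU c ((2 * k + 1) * (n + 1)))"
proof -
  let ?M = "(2 * k + 1) * n"
  have "cheb3 (- c) (?M + k) = cheb3 (- c) k * coeff G 0"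
    using arg_cong[OF G, of "\<lambda>q. poly q 0"] by (simp add: poly_cheb3 flip: poly_0_coeff_0)
  hence "(-1) ^ k * ((-1) ^ ?M * cheb4 c (?M + k)) = (-1) ^ k * (cheb4 c k * coeff G 0)"
    by (simp only: cheb3_minus power_add mult_ac)
  hence eq: "cheb4 c k * coeff G 0 = (-1) ^ n * cheb4 c (?M + k)"
    by (simp add: power_add power_mult)
  have "lucU c (2 * k + 1) * coeff G 0 = cheb3 c k * (cheb4 c k * coeff G 0)"
    using cheb4_mult_cheb3[of c 0 k] by (simp add: mult_ac)
  also have "\<dots> = (-1) ^ n * (cheb4 c (?M + k) * cheb3 c k)"
    unfolding eq by (simp add: mult_ac)
  also have "cheb4 c (?M + k) * cheb3 c k = lucU c ?M + lucU c ((2 * k + 1) * (n + 1))"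
    unfolding cheb4_mult_cheb3 by (simp add: algebra_simps)
  finally show ?thesis .
qed

lemma coeff_0_boundary_quotient:
  fixes c :: "'a::idom"
  assumes G: "lucU [:- c, 1:] ((2 * k + 1) * (n + 1)) * ([:- c, 1:] - 2) = cheb3 [:- c, 1:] k * G"
  shows "lucU c (2 * k + 1) * coeff G 0
    = (-1) ^ (k + n + 1) * (lucU c ((2 * k + 1) * (n + 1)) * (lucV c (k + 1) + lucV c k))"
proof -
  let ?M = "(2 * k + 1) * (n + 1)"
  have "lucU (- c) ?M * (- c - 2) = cheb3 (- c) k * coeff G 0"
    using arg_cong[OF G, of "\<lambda>q. poly q 0"]
    by (simp add: poly_cheb3 poly_lucU del: mult_Suc mult_Suc_right flip: poly_0_coeff_0)
  hence "(-1) ^ k * (cheb4 c k * coeff G 0) = (-1) ^ ?M * (lucU c ?M * (c + 2))"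
    by (simp add: lucU_minus cheb3_minus algebra_simps del: mult_Suc mult_Suc_right)
  moreover have "u = (-1) ^ k * v" if "(-1) ^ k * u = v" for u v :: 'a
    using that by (cases "even k") auto
  ultimately have eq: "cheb4 c k * coeff G 0 = (-1) ^ k * ((-1) ^ ?M * (lucU c ?M * (c + 2)))"
    by blast
  have sign: "(-1) ^ ?M = ((-1) ^ (n + 1) :: 'a)" unfolding power_mult by simp
  have "lucU c (2 * k + 1) * coeff G 0 = cheb3 c k * (cheb4 c k * coeff G 0)"
    using cheb4_mult_cheb3[of c 0 k] by (simp add: mult_ac)
  also have "\<dots> = (-1) ^ (k + n + 1) * (lucU c ?M * ((c + 2) * cheb3 c k))"
    unfolding eq sign by (simp add: mult_ac power_add)
  also have "(c + 2) * cheb3 c k = lucV c (k + 1) + lucV c k"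
    by (simp add: lucV_add_Suc)
  finally show ?thesis .
qed

lemma cheb3_dvd_lucU: "cheb3 y k dvd lucU y ((2 * k + 1) * n)"
  using cheb4_mult_cheb3[of y 0 k] lucU_dvd[of y "2 * k + 1" n]
  by (metis add_0 dvd_trans dvd_triv_right lucU.simps(1))

lemma F_eq_lucU: "F n = lucU [:0, 1:] n"
  by (induction n rule: F.induct) auto

lemma L_eq_lucV: "L n = lucV [:0, 1:] n"
  by (induction n rule: L.induct) auto

lemma Hankel_det_eq_cat_hankel: "Hankel_det N m k = cat_hankel [:0, 1:] N m k"
  by (simp add: Hankel_det_def cat_hankel_def fdet_def)

text \<open>At \<open>2\<close>, that is at \<open>z = 1\<close>, the value of \<open>F n\<close> is \<open>n\<close>.\<close>

lemma F_nonzero: "0 < n \<Longrightarrow> F n \<noteq> 0"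
proof -
  have "poly (F n) 2 = int n"
    by (induction n rule: F.induct) auto
  thus "0 < n \<Longrightarrow> F n \<noteq> 0" by auto
qed

lemma to_fract_power: "to_fract (x ^ n) = to_fract x ^ n"
  by (induction n) auto

lemma minus_one_power_cong:
  "(even a \<longleftrightarrow> even b) \<Longrightarrow> (-1) ^ a = ((-1) ^ b :: 'a::ring_1)"
  by (simp add: minus_one_power_iff)

lemma to_fract_sign_power:
  assumes "to_fract g = (-1) ^ d * X"
  shows "to_fract ((-1) ^ e * g ^ m) = (-1) ^ (e + d * m) * X ^ m"
proof -
  have "to_fract ((-1) ^ e * g ^ m) = (-1) ^ e * ((-1) ^ d * X) ^ m"
    by (simp only: to_fract_mult to_fract_power to_fract_uminus to_fract_1 assms)
  thus ?thesis by (simp only: power_mult_distrib power_add power_mult mult_ac)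
qed

lemma eq_mult_divideI:
  fixes d :: "'a::field"
  assumes "d \<noteq> 0" "d * x = u * v"
  shows "x = u * (v / d)"
  using assms(1) by (simp add: eq_divide_eq assms(2)[symmetric] mult.commute)

lemma to_fract_center_quotient:
  assumes G: "cheb3 [:- [:0, 1:], 1:] ((2 * k + 1) * n + k) = cheb3 [:- [:0, 1:], 1:] k * G"
  shows "to_fract (coeff G 0) = (-1) ^ n * (F_quot (2 * k + 1) n + F_quot (2 * k + 1) (n + 1))"
proof -
  have "to_fract (F (2 * k + 1)) \<noteq> 0" using F_nonzero[of "2 * k + 1"] by simp
  moreover have "to_fract (F (2 * k + 1)) * to_fract (coeff G 0)
      = (-1) ^ n * (to_fract (F ((2 * k + 1) * n)) + to_fract (F ((2 * k + 1) * (n + 1))))"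
    using arg_cong[OF coeff_0_center_quotient[OF G], of to_fract]
    by (simp only: F_eq_lucU to_fract_mult to_fract_add to_fract_power to_fract_uminus to_fract_1)
  ultimately show ?thesis unfolding F_quot_def add_divide_distrib[symmetric]
    by (rule eq_mult_divideI)
qed

lemma to_fract_boundary_quotient:
  assumes G: "lucU [:- [:0, 1:], 1:] ((2 * k + 1) * (n + 1)) * ([:- [:0, 1:], 1:] - 2)
    = cheb3 [:- [:0, 1:], 1:] k * G"
  shows "to_fract (coeff G 0)
    = (-1) ^ (k + n + 1) * (to_fract (L (k + 1) + L k) * F_quot (2 * k + 1) (n + 1))"
proof -
  have "to_fract (F (2 * k + 1)) \<noteq> 0" using F_nonzero[of "2 * k + 1"] by simp
  moreover have "to_fract (F (2 * k + 1)) * to_fract (coeff G 0)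
      = (-1) ^ (k + n + 1) * to_fract (L (k + 1) + L k) * to_fract (F ((2 * k + 1) * (n + 1)))"
    using arg_cong[OF coeff_0_boundary_quotient[OF G], of to_fract]
    by (simp only: F_eq_lucU L_eq_lucV to_fract_mult to_fract_power to_fract_uminus to_fract_1
        mult_ac)
  ultimately show ?thesis unfolding F_quot_def mult.assoc[symmetric]
    by (rule eq_mult_divideI)
qed

lemma Hankel_det_r_zero:
  assumes N: "N = (2 * k + 1) * n" and m: "m \<le> k + 1"
  shows "to_fract (Hankel_det N m k) = (F_quot (2 * k + 1) n + F_quot (2 * k + 1) (n + 1)) ^ m"
proof -
  obtain G where G:
    "cheb3 [:- [:0, 1:], 1:] ((2 * k + 1) * n + k) = cheb3 [:- [:0, 1 :: int:], 1:] k * G"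
    using cheb3_dvd_center by (rule dvdE)
  have "(-1) ^ (N * (k + m) + n * k + n * m) = ((-1) ^ 0 :: int poly fract)"
    by (rule minus_one_power_cong) (auto simp: N)
  thus ?thesis
    unfolding Hankel_det_eq_cat_hankel cat_hankel_r_zero[OF N m G[folded N]]
      to_fract_sign_power[OF to_fract_center_quotient[OF G]] by simp
qed

lemma Hankel_det_r_low:
  assumes N: "N = (2 * k + 1) * n + (k + 1 - m)" and m: "m \<le> k + 1"
  shows "to_fract (Hankel_det N m k) = (-1) ^ ((k + 1 - m) choose 2)
    * (F_quot (2 * k + 1) n + F_quot (2 * k + 1) (n + 1)) ^ m"
proof -
  let ?e = "N * (k + m) + m * k + (n + 1) * k + (k choose 2) + (m choose 2) + n * m"
  obtain G where G:
    "cheb3 [:- [:0, 1:], 1:] ((2 * k + 1) * n + k) = cheb3 [:- [:0, 1 :: int:], 1:] k * G"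
    using cheb3_dvd_center by (rule dvdE)
  have "(-1) ^ ?e = ((-1) ^ ((k + 1 - m) choose 2) :: int poly fract)"
  proof (rule minus_one_power_cong)
    \<comment> \<open>The binomial coefficients are related by computing \<open>(k + 1) choose 2\<close> in two ways, from
      \<open>k + 1 = m + t\<close> and from Pascal's rule.\<close>
    define t where "t = k + 1 - m"
    have k1: "k + 1 = m + t" using m by (simp add: t_def)
    have "(m + t) choose 2 = (m choose 2) + (t choose 2) + m * t"
      by (induction t) (auto simp: numeral_2_eq_2)
    moreover have "(k + 1) choose 2 = k + (k choose 2)" by (simp add: numeral_2_eq_2)
    ultimately have "k + (k choose 2) = (m choose 2) + (t choose 2) + m * t" using k1 by simp
    hence "even (k + (k choose 2)) \<longleftrightarrow> even ((m choose 2) + (t choose 2) + m * t)" by simp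
    moreover have "even (k + 1) \<longleftrightarrow> even (m + t)" using k1 by simp
    moreover have "even N \<longleftrightarrow> even (n + t)" unfolding N t_def[symmetric] by simp
    ultimately show "even ?e \<longleftrightarrow> even ((k + 1 - m) choose 2)"
      unfolding t_def[symmetric] by auto
  qed
  thus ?thesis
    unfolding Hankel_det_eq_cat_hankel cat_hankel_r_low[OF N m G]
      to_fract_sign_power[OF to_fract_center_quotient[OF G]] by (simp only:)
qed

lemma Hankel_det_r_middle:
  assumes N: "N = (2 * k + 1) * n + (k + 1)" and m: "m \<le> k"
  shows "to_fract (Hankel_det N m k) = (-1) ^ ((k + 1) choose 2)
    * to_fract (L (k + 1) + L k) ^ m * F_quot (2 * k + 1) (n + 1) ^ m"
proof -
  let ?e = "N * (k + m) + (n + 1) * k + (k choose 2) + (k + n + 1) * m"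
  obtain G where G: "lucU [:- [:0, 1:], 1:] ((2 * k + 1) * (n + 1)) * ([:- [:0, 1:], 1:] - 2)
      = cheb3 [:- [:0, 1 :: int:], 1:] k * G"
    using dvd_mult2[OF cheb3_dvd_lucU] by (rule dvdE)
  have "(-1) ^ ?e = ((-1) ^ ((k + 1) choose 2) :: int poly fract)"
  proof (rule minus_one_power_cong)
    have choose: "(k + 1) choose 2 = k + (k choose 2)" by (simp add: numeral_2_eq_2)
    show "even ?e \<longleftrightarrow> even ((k + 1) choose 2)" unfolding choose N by auto
  qed
  thus ?thesis
    unfolding Hankel_det_eq_cat_hankel cat_hankel_r_middle[OF N m G]
      to_fract_sign_power[OF to_fract_boundary_quotient[OF G]]
    by (simp only: power_mult_distrib mult.assoc)
qed

lemma Hankel_det_r_high: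
  assumes N: "N = (2 * k + 1) * n + (2 * k + 1 - m)" and m: "m \<le> k"
  shows "to_fract (Hankel_det N m k) = (-1) ^ ((m choose 2) + m * k)
    * to_fract (L (k + 1) + L k) ^ m * F_quot (2 * k + 1) (n + 1) ^ m"
proof -
  let ?e = "N * (k + m) + m * k + (n + 1) * k + (m choose 2) + m + (k + n + 1) * m"
  obtain G where G: "lucU [:- [:0, 1:], 1:] ((2 * k + 1) * (n + 1)) * ([:- [:0, 1:], 1:] - 2)
      = cheb3 [:- [:0, 1 :: int:], 1:] k * G"
    using dvd_mult2[OF cheb3_dvd_lucU] by (rule dvdE)
  have "(-1) ^ ?e = ((-1) ^ ((m choose 2) + m * k) :: int poly fract)"
  proof (rule minus_one_power_cong)
    have "N + m = (2 * k + 1) * n + (2 * k + 1)" using N m by simp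
    hence "even (N + m) \<longleftrightarrow> even (n + 1)" by simp
    thus "even ?e \<longleftrightarrow> even ((m choose 2) + m * k)" by auto
  qed
  thus ?thesis
    unfolding Hankel_det_eq_cat_hankel cat_hankel_r_high[OF N m G]
      to_fract_sign_power[OF to_fract_boundary_quotient[OF G]]
    by (simp only: power_mult_distrib mult.assoc)
qed

theorem theorem1p9:
  fixes m k n r N :: nat
  assumes "m \<ge> 1" and "N = (2 * k + 1) * n + r" and "r \<le> 2 * k"
  shows "(k \<ge> m - 1 \<longrightarrow>
      (r = 0 \<longrightarrow>
         to_fract (Hankel_det N m k)
         = (F_quot (2 * k + 1) n + F_quot (2 * k + 1) (n + 1)) ^ m)
      \<and> (r = k + 1 - m \<longrightarrow>
         to_fract (Hankel_det N m k)
         = (-1) ^ ((k + 1 - m) choose 2)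
           * (F_quot (2 * k + 1) n + F_quot (2 * k + 1) (n + 1)) ^ m))
    \<and> (k \<ge> m \<longrightarrow>
      (r = k + 1 \<longrightarrow>
         to_fract (Hankel_det N m k)
         = (-1) ^ ((k + 1) choose 2) * to_fract (L (k + 1) + L k) ^ m
           * F_quot (2 * k + 1) (n + 1) ^ m)
      \<and> (r = 2 * k + 1 - m \<longrightarrow>
         to_fract (Hankel_det N m k)
         = (-1) ^ ((m choose 2) + m * k) * to_fract (L (k + 1) + L k) ^ m
           * F_quot (2 * k + 1) (n + 1) ^ m))"
proof (intro conjI impI)
  assume "m - 1 \<le> k" "r = 0"
  thus "to_fract (Hankel_det N m k) = (F_quot (2 * k + 1) n + F_quot (2 * k + 1) (n + 1)) ^ m"
    using assms by (intro Hankel_det_r_zero) auto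
next
  assume "m - 1 \<le> k" "r = k + 1 - m"
  thus "to_fract (Hankel_det N m k) = (-1) ^ ((k + 1 - m) choose 2)
           * (F_quot (2 * k + 1) n + F_quot (2 * k + 1) (n + 1)) ^ m"
    using assms by (intro Hankel_det_r_low) auto
next
  assume "m \<le> k" "r = k + 1"
  thus "to_fract (Hankel_det N m k) = (-1) ^ ((k + 1) choose 2) * to_fract (L (k + 1) + L k) ^ m
           * F_quot (2 * k + 1) (n + 1) ^ m"
    using assms by (intro Hankel_det_r_middle) auto
next
  assume "m \<le> k" "r = 2 * k + 1 - m"
  thus "to_fract (Hankel_det N m k) = (-1) ^ ((m choose 2) + m * k) * to_fract (L (k + 1) + L k) ^ m
           * F_quot (2 * k + 1) (n + 1) ^ m"
    using assms by (intro Hankel_det_r_high) auto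
qed

end
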